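(* Let $G_1$ be an $r_1$-regular graph on $n_1$ vertices and $m_1$ edges, and $G_2$ an arbitrary graph on $n_2$ vertices. Then, as an identity of rational functions in $x$, $$\phi(Q(G_1 \ominus G_2); x) = (x-2-n_2-\Gamma_{Q(G_2)}(x-1))^{m_1-n_1} \cdot \prod_{i=1}^{n_2} (x-1-\nu_i(G_2))^{m_1} \cdot \prod_{i=1}^{n_1} \left( x^2 - (2+r_1+n_2+\Gamma_{Q(G_2)}(x-1))x + r_1(2+n_2+\Gamma_{Q(G_2)}(x-1)) - \nu_i(G_1) \right).$$
   Context: All graphs are finite, simple and undirected. For a graph $G$, $A(G)$ is its adjacency matrix, $D(G)$ the diagonal matrix of degrees, $Q(G)=D(G)+A(G)$ its signless Laplacian; $\phi(M;x)=\det(xI-M)$. The signless Laplacian eigenvalues of a graph $G$ on $n$ vertices are $\nu_1(G)\le\dots\le\nu_n(G)$. For an $n\times n$ matrix $M$, the $M$-coronal is the rational function $\Gamma_M(x)=\mathbf{1}_n^T(xI_n-M)^{-1}\mathbf{1}_n$ ($\mathbf{1}_n$ the all-ones column vector); $\Gamma_M(x-1)$ is its evaluation at $x-1$. The subdivision graph $\mathcal{S}(G)$ is obtained from $G$ by inserting a new vertex into every edge of $G$; $I(G)$ denotes the set of these inserted vertices. The subdivision-edge corona $G_1\ominus G_2$ of two vertex-disjoint graphs is the graph obtained from $\mathcal{S}(G_1)$ and $|I(G_1)|$ copies of $G_2$, all vertex-disjoint, by joining the $i$th vertex of $I(G_1)$ to every vertex in the $i$th copy of $G_2$. *)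

theory Defs
  imports
    "Jordan_Normal_Form.Char_Poly"
    "Jordan_Normal_Form.Gauss_Jordan_Elimination"
    "HOL-Computational_Algebra.Polynomial_Factorial"
    "HOL-Computational_Algebra.Field_as_Ring"
begin

record 'a ugraph =
  verts :: "'a set"
  edges :: "'a set set"

definition simple_graph :: "'a ugraph \<Rightarrow> bool" where
  "simple_graph G \<longleftrightarrow> finite (verts G) \<and> (\<forall>e\<in>edges G. e \<subseteq> verts G \<and> card e = 2)"

definition vdegree :: "'a ugraph \<Rightarrow> 'a \<Rightarrow> nat" where
  "vdegree G v = card {e \<in> edges G. v \<in> e}"

definition regular_graph :: "nat \<Rightarrow> 'a ugraph \<Rightarrow> bool" where
  "regular_graph r G \<longleftrightarrow> (\<forall>v\<in>verts G. vdegree G v = r)"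

definition subdivision_graph :: "'a ugraph \<Rightarrow> ('a + 'a set) ugraph" where
  "subdivision_graph G =
     \<lparr>verts = Inl ` verts G \<union> Inr ` edges G,
      edges = {{Inl v, Inr e} | v e. e \<in> edges G \<and> v \<in> e}\<rparr>"

definition inserted_verts :: "'a ugraph \<Rightarrow> ('a + 'a set) set" where
  "inserted_verts G = Inr ` edges G"

text \<open>The copies of the second graph are indexed by the inserted vertices: the vertices of the
  copy belonging to the inserted vertex \<open>w\<close> are the pairs \<open>(w, u)\<close>.\<close>

definition subdivision_edge_corona ::
    "'a ugraph \<Rightarrow> 'b ugraph \<Rightarrow> (('a + 'a set) + ('a + 'a set) \<times> 'b) ugraph"
    (infixl "\<ominus>" 65) where
  "G1 \<ominus> G2 =
     \<lparr>verts = Inl ` verts (subdivision_graph G1) \<union> Inr ` (inserted_verts G1 \<times> verts G2),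
      edges = (\<lambda>e. Inl ` e) ` edges (subdivision_graph G1)
        \<union> {(\<lambda>u. Inr (w, u)) ` e | w e. w \<in> inserted_verts G1 \<and> e \<in> edges G2}
        \<union> {{Inl w, Inr (w, u)} | w u. w \<in> inserted_verts G1 \<and> u \<in> verts G2}\<rparr>"

text \<open>Matrices of a graph are taken with respect to a list enumerating its vertices.\<close>

definition enumerates :: "'a list \<Rightarrow> 'a ugraph \<Rightarrow> bool" where
  "enumerates vs G \<longleftrightarrow> distinct vs \<and> set vs = verts G"

definition adjacency_matrix :: "'a list \<Rightarrow> 'a ugraph \<Rightarrow> real mat" where
  "adjacency_matrix vs G =
     mat (length vs) (length vs) (\<lambda>(i, j). if {vs ! i, vs ! j} \<in> edges G then 1 else 0)"

definition degree_matrix :: "'a list \<Rightarrow> 'a ugraph \<Rightarrow> real mat" where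
  "degree_matrix vs G =
     mat (length vs) (length vs) (\<lambda>(i, j). if i = j then real (vdegree G (vs ! i)) else 0)"

definition signless_laplacian :: "'a list \<Rightarrow> 'a ugraph \<Rightarrow> real mat" where
  "signless_laplacian vs G = degree_matrix vs G + adjacency_matrix vs G"

text \<open>The \<open>i\<close>-th smallest (counting from 1) eigenvalue, with algebraic multiplicity. The
  signless Laplacian is real symmetric, so all its eigenvalues are real and the list has the
  same length as \<open>vs\<close>.\<close>

definition signless_eigenvalue :: "'a list \<Rightarrow> 'a ugraph \<Rightarrow> nat \<Rightarrow> real" where
  "signless_eigenvalue vs G i =
     sorted_list_of_multiset (proots (char_poly (signless_laplacian vs G))) ! (i - 1)"

type_synonym ratfun = "real poly fract"

definition ratX :: ratfun where
  "ratX = to_fract [:0, 1:]"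

definition ratC :: "real \<Rightarrow> ratfun" where
  "ratC c = to_fract [:c:]"

definition coronal :: "real mat \<Rightarrow> ratfun" where
  "coronal M =
     (let n = dim_row M; ones = vec n (\<lambda>_. 1)
      in ones \<bullet> (the (mat_inverse (ratX \<cdot>\<^sub>m 1\<^sub>m n - map_mat ratC M)) *\<^sub>v ones))"

text \<open>Substitution of a polynomial for the variable of a rational function in lowest terms;
  meaningful when the denominator does not become zero, in particular for nonconstant \<open>p\<close>.\<close>

definition ratfun_at :: "ratfun \<Rightarrow> real poly \<Rightarrow> ratfun" where
  "ratfun_at f p = (case quot_of_fract f of (a, b) \<Rightarrow> Fract (pcompose a p) (pcompose b p))"

lemma ratfun_at_Fract:
  assumes "b \<noteq> 0" "degree p > 0"
  shows "ratfun_at (Fract a b) p = Fract (pcompose a p) (pcompose b p)"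
proof -
  obtain c d where cd: "quot_of_fract (Fract a b) = (c, d)" by fastforce
  have d: "d \<noteq> 0"
    using cd snd_quot_of_fract_nonzero[of "Fract a b"] by simp
  have "Fract a b = Fract c d"
    using quot_to_fract_quot_of_fract[of "Fract a b"] cd by (simp add: quot_to_fract_def)
  hence "a * d = c * b" using assms d by (simp add: eq_fract)
  hence "pcompose a p * pcompose d p = pcompose c p * pcompose b p"
    by (metis pcompose_mult)
  moreover have "pcompose b p \<noteq> 0" "pcompose d p \<noteq> 0"
    using assms d by (auto simp: pcompose_eq_0_iff)
  ultimately show ?thesis
    using cd by (simp add: ratfun_at_def eq_fract)
qed

lemma simple_graph_subdivision_edge_corona:
  assumes "simple_graph G1" "simple_graph G2"
  shows "simple_graph (G1 \<ominus> G2)"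
proof -
  have "finite (edges G1)"
    by (rule finite_subset[of _ "Pow (verts G1)"]) (use assms in \<open>auto simp: simple_graph_def\<close>)
  moreover have "card ((\<lambda>u. Inr (w, u)) ` e :: (('a + 'a set) + ('a + 'a set) \<times> 'b) set) = card e"
    for w :: "'a + 'a set" and e :: "'b set"
    by (rule card_image) (auto simp: inj_on_def)
  ultimately show ?thesis
    using assms unfolding simple_graph_def subdivision_edge_corona_def subdivision_graph_def
      inserted_verts_def
    by (auto 0 3 simp: card_image)
qed

end

theory Submission
  imports Defs
begin

text \<open>
  List the vertices of the corona as vertices of \<open>G1\<close>, inserted vertices, copies of \<open>G2\<close>. In
  \<open>x I - Q\<close> the copies form a block-diagonal part, and its Schur complement lowers the diagonal of the
  inserted vertices to \<open>t = x - 2 - n2 - \<Gamma>\<close>. A second Schur complement, on these inserted vertices,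
  leaves \<open>(x - r1) I - R R\<^sup>T / t\<close> on the vertices of \<open>G1\<close>, where the incidence matrix \<open>R\<close> satisfies
  \<open>R R\<^sup>T = Q(G1)\<close>; hence the factors \<open>(x - r1) t - \<nu>\<^sub>i(G1)\<close>.

  That \<open>t\<close> is nonzero, and that substituting \<open>x - 1\<close> into the coronal commutes with matrix inversion,
  both come from the matrix \<open>x I - Q(G2)\<close> bordered by a row and column of entries \<open>-1\<close>: by the Schur
  complement its determinant is \<open>(c - \<Gamma>) \<phi>(Q(G2))\<close> when the corner entry is \<open>c\<close>. With \<open>x - 1\<close> for
  \<open>x\<close> in the block and \<open>c = x - 2 - n2\<close> it is itself a characteristic polynomial.
\<close>

section \<open>Determinants indexed by lists\<close>

abbreviation lmat :: "'i list \<Rightarrow> ('i \<Rightarrow> 'i \<Rightarrow> 'k) \<Rightarrow> 'k mat" where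
  "lmat xs f \<equiv> mat (length xs) (length xs) (\<lambda>(i, j). f (xs ! i) (xs ! j))"

text \<open>Rows and columns are indexed by the list elements, so vertices serve as indices and a
  block decomposition is a list append.\<close>

definition ldet :: "'i list \<Rightarrow> ('i \<Rightarrow> 'i \<Rightarrow> 'k) \<Rightarrow> 'k::comm_ring_1" where
  "ldet xs f = det (lmat xs f)"

lemma ldet_cong:
  assumes "xs = ys" "\<And>u v. u \<in> set ys \<Longrightarrow> v \<in> set ys \<Longrightarrow> f u v = g u v"
  shows "ldet xs f = ldet ys g"
  unfolding ldet_def assms(1)
  by (intro arg_cong[where f = det] eq_matI) (auto intro: assms(2))

lemma ldet_map: "ldet (map h xs) f = ldet xs (\<lambda>u v. f (h u) (h v))"
  unfolding ldet_def by (intro arg_cong[where f = det] eq_matI) auto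

lemma ldet_Nil [simp]: "ldet [] f = 1"
  by (simp add: ldet_def)

lemma ldet_single [simp]: "ldet [x] f = f x x"
  unfolding ldet_def by (subst det_single) auto

lemma ldet_hom:
  assumes "comm_ring_hom h"
  shows "h (ldet xs f) = ldet xs (\<lambda>u v. h (f u v))"
proof -
  interpret comm_ring_hom h by fact
  show ?thesis
    unfolding ldet_def hom_det[symmetric]
    by (intro arg_cong[where f = det] eq_matI) auto
qed

lemma ldet_smult: "ldet xs (\<lambda>u v. c * f u v) = c ^ length xs * ldet xs f"
proof -
  let ?n = "length xs"
  have "mat ?n ?n (\<lambda>(i, j). c * f (xs ! i) (xs ! j)) = c \<cdot>\<^sub>m mat ?n ?n (\<lambda>(i, j). f (xs ! i) (xs ! j))"
    by (intro eq_matI) auto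
  thus ?thesis by (simp add: ldet_def)
qed

lemma ldet_transpose: "ldet xs (\<lambda>u v. f v u) = ldet xs f"
proof -
  let ?A = "mat (length xs) (length xs) (\<lambda>(i, j). f (xs ! i) (xs ! j))"
  have "mat (length xs) (length xs) (\<lambda>(i, j). f (xs ! j) (xs ! i)) = transpose_mat ?A"
    by (intro eq_matI) auto
  moreover have "det (transpose_mat ?A) = det ?A"
    by (rule det_transpose[where n = "length xs"]) auto
  ultimately show ?thesis by (simp add: ldet_def)
qed

text \<open>Rows and columns undergo the same permutation, so its sign enters twice and cancels.
  This permits replacing an arbitrary enumeration of the corona by the block order.\<close>

lemma ldet_mset_eq:
  assumes "mset xs = mset ys"
  shows "ldet xs f = ldet ys f"
proof -
  obtain p where p: "p permutes {..<length ys}" "permute_list p ys = xs"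
    using mset_eq_permutation[OF assms] by blast
  let ?n = "length ys"
  have len: "length xs = ?n" using p(2) by (metis length_permute_list)
  have p': "p permutes {0..<?n}" using p(1) by (simp add: lessThan_atLeast0)
  have xs: "xs ! i = ys ! p i" if "i < ?n" for i
    using permute_list_nth[OF p(1) that] p(2) by simp
  have lt: "p i < ?n" if "i < ?n" for i
    using permutes_in_image[OF p(1), of i] that by simp
  have rows: "det (mat ?n ?n (\<lambda>(i, j). g (ys ! p i) (ys' ! j)))
      = signof p * det (mat ?n ?n (\<lambda>(i, j). g (ys ! i) (ys' ! j)))" for g :: "'a \<Rightarrow> 'a \<Rightarrow> 'b" and ys'
  proof -
    have "mat ?n ?n (\<lambda>(i, j). g (ys ! p i) (ys' ! j))
        = mat ?n ?n (\<lambda>(i, j). mat ?n ?n (\<lambda>(i, j). g (ys ! i) (ys' ! j)) $$ (p i, j))"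
      by (intro eq_matI) (auto simp: lt)
    thus ?thesis using det_permute_rows[OF _ p', of "mat ?n ?n (\<lambda>(i, j). g (ys ! i) (ys' ! j))"] by simp
  qed
  have "ldet xs f = det (mat ?n ?n (\<lambda>(i, j). f (ys ! p i) (xs ! j)))"
    unfolding ldet_def len by (intro arg_cong[where f = det] eq_matI) (auto simp: xs)
  also have "\<dots> = signof p * det (mat ?n ?n (\<lambda>(i, j). f (ys ! i) (xs ! j)))"
    by (rule rows)
  \<comment> \<open>Transposing turns the remaining column permutation into a row permutation, so
    that \<open>rows\<close> applies again.\<close>
  also have "det (mat ?n ?n (\<lambda>(i, j). f (ys ! i) (xs ! j)))
      = det (mat ?n ?n (\<lambda>(i, j). f (ys ! j) (ys ! p i)))"
    by (subst det_transpose[where n = ?n, symmetric], simp,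
        intro arg_cong[where f = det] eq_matI) (auto simp: xs)
  also have "\<dots> = signof p * det (mat ?n ?n (\<lambda>(i, j). f (ys ! j) (ys ! i)))"
    by (rule rows[of "\<lambda>u v. f v u"])
  also have "det (mat ?n ?n (\<lambda>(i, j). f (ys ! j) (ys ! i))) = ldet ys f"
    using ldet_transpose[of ys f] by (simp add: ldet_def)
  also have "signof p * (signof p * ldet ys f) = ldet ys f"
    using signof_pm_one[of p, where ?'a = 'b] by auto
  finally show ?thesis .
qed

lemma ldet_append_lower_zero:
  fixes f :: "'i \<Rightarrow> 'i \<Rightarrow> 'k::idom"
  assumes "\<And>u v. u \<in> set ys \<Longrightarrow> v \<in> set xs \<Longrightarrow> f u v = 0"
  shows "ldet (xs @ ys) f = ldet xs f * ldet ys f"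
proof -
  let ?n = "length xs" and ?m = "length ys"
  let ?M = "\<lambda>as bs. mat (length as) (length bs) (\<lambda>(i, j). f (as ! i) (bs ! j))"
  have "?M (xs @ ys) (xs @ ys) = four_block_mat (?M xs xs) (?M xs ys) (0\<^sub>m ?m ?n) (?M ys ys)"
    by (intro eq_matI) (auto simp: nth_append intro!: assms)
  thus ?thesis
    unfolding ldet_def
    by (simp add: det_four_block_mat_lower_left_zero[where n = ?n and m = ?m])
qed

lemma ldet_diag:
  fixes t :: "'k::idom"
  assumes "distinct xs"
  shows "ldet xs (\<lambda>u v. if u = v then t else 0) = t ^ length xs"
  using assms
proof (induction xs)
  case (Cons x xs)
  have "ldet ([x] @ xs) (\<lambda>u v. if u = v then t else 0)
      = ldet [x] (\<lambda>u v. if u = v then t else 0) * ldet xs (\<lambda>u v. if u = v then t else 0)"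
    using Cons.prems by (intro ldet_append_lower_zero) auto
  thus ?case using Cons by simp
qed simp

text \<open>This is the Kronecker product of an identity matrix with \<open>f\<close>: the induction
  splits off one diagonal block per element of \<open>es\<close>.\<close>

lemma ldet_product:
  fixes f :: "'u \<Rightarrow> 'u \<Rightarrow> 'k::idom"
  assumes "distinct es"
  shows "ldet (List.product es us) (\<lambda>p q. if fst p = fst q then f (snd p) (snd q) else 0)
    = ldet us f ^ length es"
  using assms
proof (induction es)
  case (Cons e es)
  let ?F = "\<lambda>p q. if fst p = fst q then f (snd p) (snd q) else 0"
  have "ldet (List.product (e # es) us) ?F = ldet (map (Pair e) us) ?F * ldet (List.product es us) ?F"
    using Cons.prems by (simp, intro ldet_append_lower_zero) auto
  also have "ldet (map (Pair e) us) ?F = ldet us f"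
    by (simp add: ldet_map)
  finally show ?case using Cons by simp
qed simp

section \<open>Schur complements and inverses over index sets\<close>

lemma sum_nth_eq_sum_set:
  assumes "distinct xs"
  shows "(\<Sum>i = 0..<length xs. h (xs ! i)) = (\<Sum>x\<in>set xs. h x)"
  using sum_list_distinct_conv_sum_set[OF assms, of h] sum_list_sum_nth[of "map h xs"] by simp

definition right_inverse_on :: "'i set \<Rightarrow> ('i \<Rightarrow> 'i \<Rightarrow> 'k) \<Rightarrow> ('i \<Rightarrow> 'i \<Rightarrow> 'k::comm_ring_1) \<Rightarrow> bool" where
  "right_inverse_on S f g \<longleftrightarrow> (\<forall>u\<in>S. \<forall>w\<in>S. (\<Sum>v\<in>S. f u v * g v w) = (if u = w then 1 else 0))"

text \<open>Multiplying on the right by the unit lower triangular \<open>?L\<close> clears the lower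
  left block and leaves the Schur complement in the upper left one.\<close>

lemma ldet_schur_complement:
  fixes f g :: "'i \<Rightarrow> 'i \<Rightarrow> 'k::idom"
  assumes "distinct ys" and "right_inverse_on (set ys) f g"
  shows "ldet (xs @ ys) f =
    ldet xs (\<lambda>u v. f u v - (\<Sum>k\<in>set ys. \<Sum>l\<in>set ys. f u k * g k l * f l v)) * ldet ys f"
proof -
  let ?n = "length xs" and ?m = "length ys"
  let ?M = "\<lambda>f as bs. mat (length as) (length bs) (\<lambda>(i, j). f (as ! i) (bs ! j))"
  \<comment> \<open>The inverse of the lower right block times the lower left block; its negative is
    the off-diagonal block of \<open>?L\<close>.\<close>
  let ?c = "\<lambda>k v. \<Sum>l\<in>set ys. g k l * f l v"
  let ?s = "\<lambda>u v. f u v - (\<Sum>k\<in>set ys. f u k * ?c k v)"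
  let ?A = "four_block_mat (?M f xs xs) (?M f xs ys) (?M f ys xs) (?M f ys ys)"
  let ?L = "four_block_mat (1\<^sub>m ?n) (0\<^sub>m ?n ?m) (?M (\<lambda>k v. - ?c k v) ys xs) (1\<^sub>m ?m)"
  let ?U = "four_block_mat (?M ?s xs xs) (?M f xs ys) (0\<^sub>m ?m ?n) (?M f ys ys)"
  have prod: "?M f as ys * ?M (\<lambda>k v. - ?c k v) ys xs
      = ?M (\<lambda>u v. - (\<Sum>k\<in>set ys. f u k * ?c k v)) as xs" for as
    by (intro eq_matI)
       (auto simp: scalar_prod_def sum_nth_eq_sum_set[OF assms(1), symmetric] sum_negf)
  have zero: "f u v = (\<Sum>k\<in>set ys. f u k * ?c k v)" if "u \<in> set ys" for u v
  proof -
    have "(\<Sum>k\<in>set ys. f u k * ?c k v) = (\<Sum>l\<in>set ys. (\<Sum>k\<in>set ys. f u k * g k l) * f l v)"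
      by (simp add: sum_distrib_left sum_distrib_right mult.assoc) (rule sum.swap)
    also have "\<dots> = (\<Sum>l\<in>set ys. if u = l then f l v else 0)"
      using assms(2) that by (intro sum.cong refl) (auto simp: right_inverse_on_def)
    also have "\<dots> = f u v" using that by simp
    finally show ?thesis by simp
  qed
  have "?A * ?L = ?U"
    by (subst mult_four_block_mat[where ?nr1.0 = ?n and ?n1.0 = ?n and ?n2.0 = ?m and ?nr2.0 = ?m
          and ?nc1.0 = ?n and ?nc2.0 = ?m])
       (auto simp: prod zero[symmetric] intro!: arg_cong4[where f = four_block_mat] eq_matI)
  moreover have "det ?L = 1"
    by (subst det_four_block_mat_upper_right_zero[where n = ?n and m = ?m]) auto
  moreover have "det (?A * ?L) = det ?A * det ?L"
    by (rule det_mult[where n = "?n + ?m"]) auto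
  moreover have "det ?U = ldet xs ?s * ldet ys f"
    unfolding ldet_def by (rule det_four_block_mat_lower_left_zero[where n = ?n and m = ?m]) auto
  moreover have "ldet (xs @ ys) f = det ?A"
    unfolding ldet_def by (intro arg_cong[where f = det] eq_matI) (auto simp: nth_append)
  ultimately show ?thesis by (simp add: sum_distrib_left mult.assoc)
qed

text \<open>Stated for any ring homomorphism because it serves three: the embedding into rational
  functions, this embedding after a substitution, and evaluation at a rational function.\<close>

lemma hom_char_poly:
  assumes "comm_ring_hom h" "distinct vs"
  shows "h (char_poly (lmat vs q)) = ldet vs (\<lambda>u v. (if u = v then h [:0, 1:] else 0) - h [:q u v:])"
proof -
  interpret comm_ring_hom h by fact
  have "char_poly (lmat vs q) = ldet vs (\<lambda>u v. (if u = v then [:0, 1:] else 0) - [:q u v:])"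
    unfolding char_poly_def char_poly_matrix_def ldet_def
    by (intro arg_cong[where f = det] eq_matI)
       (auto simp: nth_eq_iff_index_eq[OF assms(2)])
  thus ?thesis
    by (simp only: ldet_hom[OF assms(1)]) (intro ldet_cong refl, simp add: hom_minus)
qed

text \<open>Turns the positional result of \<open>mat_inverse\<close>, which occurs in
  \<open>coronal\<close>, into an inverse indexed by list elements.\<close>

lemma mat_inverse_lmat:
  fixes f :: "'i \<Rightarrow> 'i \<Rightarrow> 'k::field"
  assumes "distinct us" "ldet us f \<noteq> 0"
  obtains g where "right_inverse_on (set us) f g" "mat_inverse (lmat us f) = Some (lmat us g)"
proof -
  let ?n = "length us"
  have carrier: "lmat us f \<in> carrier_mat ?n ?n" by simp
  obtain B where B: "mat_inverse (lmat us f) = Some B"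
    using mat_inverse(1)[OF carrier, of "()"] det_non_zero_imp_unit[OF carrier, of "()"] assms(2)
    unfolding ldet_def by blast
  have inv: "lmat us f * B = 1\<^sub>m ?n" and Bc: "B \<in> carrier_mat ?n ?n"
    using mat_inverse(2)[OF carrier B] by auto
  define idx where "idx u = (THE i. i < ?n \<and> us ! i = u)" for u
  have idx: "idx (us ! i) = i" if "i < ?n" for i
    unfolding idx_def using that by (intro the_equality) (auto simp: nth_eq_iff_index_eq[OF assms(1)])
  define g where "g u v = B $$ (idx u, idx v)" for u v
  have "B = lmat us g" using Bc by (intro eq_matI) (auto simp: g_def idx)
  moreover have "right_inverse_on (set us) f g"
    unfolding right_inverse_on_def
  proof (intro ballI)
    fix u w assume "u \<in> set us" "w \<in> set us"
    then obtain i j where ij: "i < ?n" "us ! i = u" "j < ?n" "us ! j = w"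
      by (auto simp: in_set_conv_nth)
    have "(\<Sum>v\<in>set us. f u v * g v w) = (\<Sum>k = 0..<?n. f u (us ! k) * g (us ! k) w)"
      by (rule sum_nth_eq_sum_set[OF assms(1), symmetric])
    also have "\<dots> = (lmat us f * B) $$ (i, j)"
      using ij Bc by (auto simp: scalar_prod_def g_def idx intro!: sum.cong)
    also have "\<dots> = (if u = w then 1 else 0)"
      unfolding inv using ij by (auto simp: nth_eq_iff_index_eq[OF assms(1)])
    finally show "(\<Sum>v\<in>set us. f u v * g v w) = (if u = w then 1 else 0)" .
  qed
  ultimately show ?thesis using that B by blast
qed

definition bordered :: "'k \<Rightarrow> ('u \<Rightarrow> 'u \<Rightarrow> 'k) \<Rightarrow> 'u option \<Rightarrow> 'u option \<Rightarrow> 'k::comm_ring_1" where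
  "bordered c f p q = (case p of
      None \<Rightarrow> (case q of None \<Rightarrow> c | Some _ \<Rightarrow> - 1)
    | Some u \<Rightarrow> (case q of None \<Rightarrow> - 1 | Some v \<Rightarrow> f u v))"

text \<open>Eliminating the block of \<open>f\<close> corrects the corner by the border row times
  \<open>g\<close> times the border column. The two signs cancel, leaving the sum of all entries of
  \<open>g\<close>, which is a coronal when \<open>f\<close> is a characteristic matrix.\<close>

lemma ldet_bordered:
  fixes f g :: "'u \<Rightarrow> 'u \<Rightarrow> 'k::idom"
  assumes "distinct us" "right_inverse_on (set us) f g"
  shows "ldet (None # map Some us) (bordered c f) = (c - (\<Sum>u\<in>set us. \<Sum>v\<in>set us. g u v)) * ldet us f"
proof -
  let ?g = "\<lambda>p q. g (the p) (the q)"
  have "right_inverse_on (set (map Some us)) (bordered c f) ?g"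
    using assms(2) by (simp add: right_inverse_on_def sum.reindex bordered_def)
  hence "ldet ([None] @ map Some us) (bordered c f) = ldet [None] (\<lambda>p q. bordered c f p q
      - (\<Sum>k\<in>set (map Some us). \<Sum>l\<in>set (map Some us). bordered c f p k * ?g k l * bordered c f l q))
      * ldet (map Some us) (bordered c f)"
    using assms(1) by (intro ldet_schur_complement) (auto simp: distinct_map)
  thus ?thesis
    by (simp add: sum.reindex bordered_def ldet_map)
qed

section \<open>Spectra of real symmetric matrices\<close>

text \<open>For an eigenvector \<open>v\<close>, the Hermitian form of \<open>A\<close> at
  \<open>v\<close> is its own conjugate and equals \<open>z\<close> times the positive squared norm
  of \<open>v\<close>.\<close>

lemma real_symmetric_eigenvalue_real:
  fixes A :: "real mat"
  assumes A: "A \<in> carrier_mat n n"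
    and sym: "\<And>i j. i < n \<Longrightarrow> j < n \<Longrightarrow> A $$ (i, j) = A $$ (j, i)"
    and ev: "eigenvalue (map_mat complex_of_real A) z"
  shows "z \<in> \<real>"
proof -
  obtain v where v: "v \<in> carrier_vec n" "v \<noteq> 0\<^sub>v n" "map_mat complex_of_real A *\<^sub>v v = z \<cdot>\<^sub>v v"
    using ev A by (auto simp: eigenvalue_def eigenvector_def)
  have row: "(\<Sum>j<n. of_real (A $$ (i, j)) * v $ j) = z * v $ i" if "i < n" for i
    using arg_cong[OF v(3), of "\<lambda>w. w $ i"] that v(1) A
    by (simp add: scalar_prod_def lessThan_atLeast0)
  \<comment> \<open>\<open>s\<close> is the Hermitian form at \<open>v\<close>, and \<open>q\<close>
    is the squared norm.\<close>
  define s where "s = (\<Sum>i<n. \<Sum>j<n. cnj (v $ i) * of_real (A $$ (i, j)) * v $ j)"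
  define q where "q = (\<Sum>i<n. (cmod (v $ i))\<^sup>2)"
  have "cnj s = (\<Sum>i<n. \<Sum>j<n. cnj (v $ j) * of_real (A $$ (i, j)) * v $ i)"
    unfolding s_def by (simp add: mult_ac)
  also have "\<dots> = (\<Sum>j<n. \<Sum>i<n. cnj (v $ j) * of_real (A $$ (j, i)) * v $ i)"
    by (subst sum.swap) (intro sum.cong refl, simp add: sym)
  finally have s: "cnj s = s" by (simp add: s_def)
  have "s = (\<Sum>i<n. cnj (v $ i) * (z * v $ i))"
    unfolding s_def by (intro sum.cong refl) (simp flip: row add: sum_distrib_left mult.assoc)
  also have "\<dots> = z * of_real q"
    unfolding q_def of_real_sum sum_distrib_left
    by (intro sum.cong refl) (simp only: complex_norm_square mult_ac)
  finally have zq: "s = z * of_real q" .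
  obtain i where "i < n" "v $ i \<noteq> 0"
    using v(1,2) by (metis carrier_vecD eq_vecI index_zero_vec)
  hence "q \<noteq> 0"
    unfolding q_def by (subst sum_nonneg_eq_0_iff) auto
  moreover have "cnj z * of_real q = z * of_real q"
    using s zq by (metis complex_cnj_complex_of_real complex_cnj_mult)
  ultimately have "cnj z = z" by simp
  thus ?thesis by (simp add: Reals_cnj_iff)
qed

text \<open>The complex factorization has only real roots, so it descends along the injective
  embedding of the reals. Hence the sorted root list behind \<open>signless_eigenvalue\<close> has
  full length.\<close>

lemma char_poly_real_symmetric_splits:
  fixes A :: "real mat"
  assumes A: "A \<in> carrier_mat n n"
    and sym: "\<And>i j. i < n \<Longrightarrow> j < n \<Longrightarrow> A $$ (i, j) = A $$ (j, i)"
  shows "char_poly A = (\<Prod>a\<in>#proots (char_poly A). [:- a, 1:])"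
    and "size (proots (char_poly A)) = n"
proof -
  let ?C = "map_mat complex_of_real A"
  interpret cr: map_poly_inj_idom_hom complex_of_real ..
  have C: "?C \<in> carrier_mat n n" using A by simp
  obtain as where as: "char_poly ?C = (\<Prod>a\<leftarrow>as. [:- a, 1:])" "length as = n"
    using char_poly_factorized[OF C] by blast
  have "a \<in> \<real>" if "a \<in> set as" for a
  proof (rule real_symmetric_eigenvalue_real[OF A sym])
    have "poly (char_poly ?C) a = 0"
      unfolding as(1) poly_prod_list using that by (auto simp: prod_list_zero_iff)
    thus "eigenvalue ?C a" using eigenvalue_root_char_poly[OF C] by simp
  qed
  hence Re: "map complex_of_real (map Re as) = as"
    by (auto intro!: map_idI)
  have "map_poly complex_of_real (char_poly A) = char_poly ?C"
    by (rule of_real_hom.char_poly_hom[OF A, symmetric])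
  also have "\<dots> = (\<Prod>a\<leftarrow>map complex_of_real (map Re as). [:- a, 1:])"
    unfolding Re as(1) ..
  also have "\<dots> = map_poly complex_of_real (\<Prod>a\<leftarrow>map Re as. [:- a, 1:])"
    unfolding cr.hom_prod_list by (simp add: o_def)
  finally have cp: "char_poly A = (\<Prod>a\<leftarrow>map Re as. [:- a, 1:])" by simp
  have "proots (\<Prod>a\<leftarrow>bs. [:- a, 1:]) = mset bs" for bs :: "real list"
  proof (induction bs)
    case (Cons b bs)
    have "(\<Prod>a\<leftarrow>bs. [:- a, 1:]) \<noteq> 0" by (auto simp: prod_list_zero_iff)
    thus ?case using Cons by (simp add: proots_mult del: mult_pCons_left)
  qed simp
  hence pr: "proots (char_poly A) = mset (map Re as)" unfolding cp .
  show "size (proots (char_poly A)) = n" unfolding pr using as(2) by simp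
  show "char_poly A = (\<Prod>a\<in>#proots (char_poly A). [:- a, 1:])"
    unfolding pr by (subst cp) (simp flip: prod_mset_prod_list add: multiset.map_comp)
qed

text \<open>Passes from roots as a multiset to the numbered eigenvalues, which are counted from 1
  while list positions start at 0.\<close>

lemma prod_mset_conv_sorted_list:
  fixes f :: "'a::linorder \<Rightarrow> 'b::comm_monoid_mult"
  shows "(\<Prod>a\<in>#A. f a) = (\<Prod>i=1..size A. f (sorted_list_of_multiset A ! (i - 1)))"
proof -
  let ?l = "sorted_list_of_multiset A"
  have "(\<Prod>a\<in>#A. f a) = (\<Prod>a\<leftarrow>?l. f a)"
    by (metis mset_sorted_list_of_multiset mset_map prod_mset_prod_list)
  also have "\<dots> = (\<Prod>i<size A. f (?l ! i))"
    using prod.list_conv_set_nth[of "map f ?l"]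
    by (simp add: lessThan_atLeast0 flip: size_mset)
  finally show ?thesis 
    by (simp add: prod.atLeast1_atMost_eq)
qed

section \<open>Coronals\<close>

lemma comm_ring_hom_to_fract: "comm_ring_hom (to_fract :: 'a::idom \<Rightarrow> 'a fract)"
  by unfold_locales auto

lemma comm_ring_hom_to_fract_pcompose:
  "comm_ring_hom (\<lambda>q :: 'a::idom poly. to_fract (pcompose q p))"
  by unfold_locales (auto simp: pcompose_add pcompose_mult pcompose_1)

text \<open>With \<open>b\<close> the bordered determinant with corner 0, the coronal is the
  quotient of \<open>- b\<close> by the characteristic polynomial. Both are polynomials, so
  \<open>p\<close> can be substituted in each, and the same bordered identity holds after the
  substitution.\<close>

lemma ratfun_at_coronal:
  assumes "distinct us" "degree p > 0"
    and g: "right_inverse_on (set us) (\<lambda>u v. (if u = v then to_fract p else 0) - ratC (q u v)) g"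
  shows "ratfun_at (coronal (lmat us q)) p = (\<Sum>u\<in>set us. \<Sum>v\<in>set us. g u v)"
proof -
  let ?M = "lmat us q"
  let ?h = "\<lambda>a :: real poly. to_fract (pcompose a p)"
  define b where "b = ldet (None # map Some us) (bordered 0 (\<lambda>u v. (if u = v then [:0, 1:] else 0) - [:q u v:]))"
  \<comment> \<open>Applied twice: to the plain embedding, with the inverse \<open>k\<close> that
    defines the coronal, and to the embedding after substituting \<open>p\<close>, with the given
    \<open>g\<close>.\<close>
  have border: "h b = - (\<Sum>u\<in>set us. \<Sum>v\<in>set us. k u v) * h (char_poly ?M)"
    if "comm_ring_hom h"
      and "right_inverse_on (set us) (\<lambda>u v. (if u = v then h [:0, 1:] else 0) - h [:q u v:]) k"
    for h :: "real poly \<Rightarrow> ratfun" and k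
  proof -
    interpret comm_ring_hom h by fact
    have "h b = ldet (None # map Some us) (bordered 0 (\<lambda>u v. (if u = v then h [:0, 1:] else 0) - h [:q u v:]))"
      unfolding b_def ldet_hom[OF that(1)]
      by (intro ldet_cong refl) (auto simp: bordered_def hom_minus hom_uminus split: option.splits)
    also have "\<dots> = - (\<Sum>u\<in>set us. \<Sum>v\<in>set us. k u v) * h (char_poly ?M)"
      using ldet_bordered[OF assms(1) that(2), of 0] hom_char_poly[OF that(1) assms(1), of q] by simp
    finally show ?thesis .
  qed
  have "lead_coeff (char_poly ?M) = 1"
    using degree_monic_char_poly[of ?M "length us"] by auto
  hence nz: "char_poly ?M \<noteq> 0" by auto
  hence nz': "pcompose (char_poly ?M) p \<noteq> 0"
    using assms(2) by (auto simp: pcompose_eq_0_iff)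
  let ?f = "\<lambda>u v. (if u = v then ratX else 0) - ratC (q u v)"
  have cp: "to_fract (char_poly ?M) = ldet us ?f"
    unfolding ratX_def ratC_def by (rule hom_char_poly[OF comm_ring_hom_to_fract assms(1)])
  hence "ldet us ?f \<noteq> 0" using nz by (metis to_fract_eq_0_iff)
  then obtain k where k: "right_inverse_on (set us) ?f k" "mat_inverse (lmat us ?f) = Some (lmat us k)"
    using mat_inverse_lmat[OF assms(1)] by blast
  have "ratX \<cdot>\<^sub>m 1\<^sub>m (length us) - map_mat ratC ?M = lmat us ?f"
    by (intro eq_matI) (auto simp: nth_eq_iff_index_eq[OF assms(1)])
  hence "coronal ?M = (\<Sum>u\<in>set us. \<Sum>v\<in>set us. k u v)"
    unfolding coronal_def using k(2)
    by (simp add: Let_def scalar_prod_def sum_nth_eq_sum_set[OF assms(1), symmetric])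
  hence "to_fract b = - coronal ?M * to_fract (char_poly ?M)"
    using border[OF comm_ring_hom_to_fract k(1)[unfolded ratX_def ratC_def]] by simp
  hence "coronal ?M = to_fract (- b) / to_fract (char_poly ?M)"
    using nz by (simp add: field_simps)
  also have "\<dots> = Fract (- b) (char_poly ?M)"
    by (simp add: to_fract_def)
  finally have "ratfun_at (coronal ?M) p = Fract (pcompose (- b) p) (pcompose (char_poly ?M) p)"
    using ratfun_at_Fract[OF nz assms(2)] by simp
  also have "\<dots> = - ?h b / ?h (char_poly ?M)"
    by (simp add: to_fract_def pcompose_uminus)
  also have "?h b = - (\<Sum>u\<in>set us. \<Sum>v\<in>set us. g u v) * ?h (char_poly ?M)"
    using g by (intro border comm_ring_hom_to_fract_pcompose) (simp add: ratC_def pcompose_pCons cong: if_cong)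
  finally show ?thesis using nz' by simp
qed

lemma comm_ring_hom_ratC: "comm_ring_hom ratC"
  by unfold_locales (simp_all add: ratC_def flip: to_fract_add to_fract_mult to_fract_1 one_pCons)

lemma ratC_of_nat: "ratC (real n) = of_nat n"
proof -
  interpret comm_ring_hom ratC by (rule comm_ring_hom_ratC)
  show ?thesis by (rule hom_of_nat)
qed

text \<open>The shifts \<open>c\<close> and \<open>d\<close> can be moved into a real matrix
  \<open>k\<close>; the determinant is then the characteristic polynomial of \<open>k\<close>, which
  is monic.\<close>

lemma ldet_bordered_char_matrix_nonzero:
  fixes q :: "'u \<Rightarrow> 'u \<Rightarrow> real"
  assumes "distinct us"
  shows "ldet (None # map Some us)
    (bordered (ratX - ratC c) (\<lambda>u v. (if u = v then ratX - ratC d else 0) - ratC (q u v))) \<noteq> 0"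
proof -
  interpret comm_ring_hom ratC by (rule comm_ring_hom_ratC)
  let ?us = "None # map Some us"
  define k where "k p r = (case p of
      None \<Rightarrow> (case r of None \<Rightarrow> c | Some _ \<Rightarrow> 1)
    | Some u \<Rightarrow> (case r of None \<Rightarrow> 1 | Some v \<Rightarrow> (if u = v then d else 0) + q u v))" for p r
  let ?M = "lmat ?us k"
  have "lead_coeff (char_poly ?M) = 1"
    using degree_monic_char_poly[of ?M "length ?us"] by auto
  hence nz: "to_fract (char_poly ?M) \<noteq> 0" by auto
  have "distinct ?us" using assms by (auto simp: distinct_map)
  hence "to_fract (char_poly ?M) = ldet ?us (\<lambda>u v. (if u = v then ratX else 0) - ratC (k u v))"
    unfolding ratX_def ratC_def by (rule hom_char_poly[OF comm_ring_hom_to_fract])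
  also have "\<dots> = ldet ?us
      (bordered (ratX - ratC c) (\<lambda>u v. (if u = v then ratX - ratC d else 0) - ratC (q u v)))"
    by (intro ldet_cong refl) (auto simp: bordered_def k_def hom_add split: option.splits)
  finally show ?thesis using nz by (rule subst)
qed

section \<open>The block structure of the corona\<close>

text \<open>Index \<open>Inl (Inl v)\<close> stands for a vertex of the first graph, \<open>Inl (Inr e)\<close> for the vertex inserted
  into \<open>e\<close>, and \<open>Inr (e, u)\<close> for the vertex \<open>u\<close> of the copy attached to it.\<close>

fun corona_entry ::
    "'k \<Rightarrow> 'k \<Rightarrow> ('v \<Rightarrow> 'e \<Rightarrow> 'k) \<Rightarrow> ('u \<Rightarrow> 'u \<Rightarrow> 'k) \<Rightarrow> ('v + 'e) + 'e \<times> 'u \<Rightarrow> ('v + 'e) + 'e \<times> 'u \<Rightarrow> 'k::comm_ring_1"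
  where
    "corona_entry a b R N (Inl (Inl v)) (Inl (Inl v')) = (if v = v' then a else 0)"
  | "corona_entry a b R N (Inl (Inl v)) (Inl (Inr e)) = - R v e"
  | "corona_entry a b R N (Inl (Inl v)) (Inr p) = 0"
  | "corona_entry a b R N (Inl (Inr e)) (Inl (Inl v)) = - R v e"
  | "corona_entry a b R N (Inl (Inr e)) (Inl (Inr e')) = (if e = e' then b else 0)"
  | "corona_entry a b R N (Inl (Inr e)) (Inr (e', u)) = (if e = e' then - 1 else 0)"
  | "corona_entry a b R N (Inr p) (Inl (Inl v)) = 0"
  | "corona_entry a b R N (Inr (e, u)) (Inl (Inr e')) = (if e = e' then - 1 else 0)"
  | "corona_entry a b R N (Inr (e, u)) (Inr (e', u')) = (if e = e' then N u u' else 0)"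

lemma sum_if_const: "(\<Sum>u\<in>S. if P then h u else 0) = (if P then \<Sum>u\<in>S. h u else 0)"
  by simp

text \<open>An inserted vertex meets only its own copy, through a row of entries \<open>-1\<close>.
  Eliminating the copies thus changes only the diagonal entry \<open>b\<close>, to \<open>t\<close>,
  and the inserted vertices form the scalar block \<open>t I\<close>, which is eliminated
  next.\<close>

lemma ldet_corona:
  fixes a b :: "'k::field" and vs :: "'v list" and es :: "'e list" and us :: "'u list"
  assumes "distinct es" "distinct us" "right_inverse_on (set us) N g"
    and t: "t = b - (\<Sum>u\<in>set us. \<Sum>v\<in>set us. g u v)" "t \<noteq> 0"
  shows "ldet (map Inl (map Inl vs @ map Inr es) @ map Inr (List.product es us)) (corona_entry a b R N)
    = ldet vs (\<lambda>v w. (if v = w then a else 0) - (\<Sum>e\<in>set es. R v e * R w e) / t)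
      * t ^ length es * ldet us N ^ length es"
proof -
  let ?F = "corona_entry a b R N"
  let ?Y = "map Inr (List.product es us) :: (('v + 'e) + 'e \<times> 'u) list"
  \<comment> \<open>The inverse of the block of all copies: one diagonal block \<open>g\<close> for
    each element of \<open>es\<close>.\<close>
  let ?g = "\<lambda>p q. if fst (projr p) = fst (projr q) then g (snd (projr p)) (snd (projr q)) else 0"
  let ?G = "\<Sum>u\<in>set us. \<Sum>v\<in>set us. g u v"
  have sumY: "(\<Sum>p\<in>set ?Y. h p) = (\<Sum>e\<in>set es. \<Sum>u\<in>set us. h (Inr (e, u)))" for h :: "_ \<Rightarrow> 'k"
    by (simp add: sum.reindex sum.cartesian_product)
  have "right_inverse_on (set ?Y) ?F ?g"
    unfolding right_inverse_on_def sumY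
  proof (intro ballI)
    fix p q assume "p \<in> set ?Y" "q \<in> set ?Y"
    then obtain e u e' u' where p: "p = Inr (e, u)" "e \<in> set es" "u \<in> set us"
      and q: "q = Inr (e', u')" "e' \<in> set es" "u' \<in> set us" by auto
    have "(\<Sum>e''\<in>set es. \<Sum>v\<in>set us. ?F p (Inr (e'', v)) * ?g (Inr (e'', v)) q)
        = (\<Sum>e''\<in>set es. if e = e'' then (if e = e' then \<Sum>v\<in>set us. N u v * g v u' else 0) else 0)"
      unfolding p q by (intro sum.cong refl) auto
    also have "\<dots> = (if p = q then 1 else 0)"
      using p q assms(3) by (auto simp: right_inverse_on_def)
    finally show "(\<Sum>e''\<in>set es. \<Sum>v\<in>set us. ?F p (Inr (e'', v)) * ?g (Inr (e'', v)) q)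
      = (if p = q then 1 else 0)" .
  qed
  hence "ldet (map Inl (map Inl vs @ map Inr es) @ ?Y) ?F
      = ldet (map Inl (map Inl vs @ map Inr es))
          (\<lambda>p q. ?F p q - (\<Sum>k\<in>set ?Y. \<Sum>l\<in>set ?Y. ?F p k * ?g k l * ?F l q)) * ldet ?Y ?F"
    using assms(1,2) by (intro ldet_schur_complement) (auto simp: distinct_map distinct_product)
  also have "ldet ?Y ?F = ldet us N ^ length es"
    unfolding ldet_map ldet_product[OF assms(1), symmetric]
    by (intro ldet_cong refl) (auto simp: split_beta)
  \<comment> \<open>The Schur complement has the same shape again, with \<open>t\<close> in place of
    \<open>b\<close>.\<close>
  also have "ldet (map Inl (map Inl vs @ map Inr es))
          (\<lambda>p q. ?F p q - (\<Sum>k\<in>set ?Y. \<Sum>l\<in>set ?Y. ?F p k * ?g k l * ?F l q))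
      = ldet (map Inl vs @ map Inr es) (\<lambda>p q. corona_entry a t R N (Inl p) (Inl q))"
    unfolding ldet_map
  proof (intro ldet_cong refl)
    fix p q assume pq: "p \<in> set (map Inl vs @ map Inr es)" "q \<in> set (map Inl vs @ map Inr es)"
    show "?F (Inl p) (Inl q) - (\<Sum>k\<in>set ?Y. \<Sum>l\<in>set ?Y. ?F (Inl p) k * ?g k l * ?F l (Inl q))
      = corona_entry a t R N (Inl p) (Inl q)"
    proof (cases "(\<exists>v. p = Inl v) \<or> (\<exists>v. q = Inl v)")
      \<comment> \<open>Vertices of the first graph have zero entries towards all copies, so the
        correction term vanishes.\<close>
      case True
      thus ?thesis unfolding sumY by (cases p; cases q) auto
    next
      case False
      then obtain e e' where p: "p = Inr e" "e \<in> set es" and q: "q = Inr e'" "e' \<in> set es"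
        using pq by (cases p; cases q) auto
      have "(\<Sum>k\<in>set ?Y. \<Sum>l\<in>set ?Y. ?F (Inl p) k * ?g k l * ?F l (Inl q))
        = (\<Sum>d\<in>set es. \<Sum>u\<in>set us. \<Sum>d'\<in>set es. \<Sum>u'\<in>set us.
            (if e = d then - 1 else 0) * (if d = d' then g u u' else 0) * (if d' = e' then - 1 else 0))"
        unfolding sumY p q by (simp cong: if_cong)
      \<comment> \<open>Nested conditionals let the sums over \<open>d\<close> and \<open>d'\<close>
        collapse; the two entries \<open>-1\<close> multiply to 1.\<close>
      also have "\<dots> = (\<Sum>d\<in>set es. \<Sum>u\<in>set us. \<Sum>d'\<in>set es. \<Sum>u'\<in>set us.
          if e = d then if d = d' then if d' = e' then g u u' else 0 else 0 else 0)"
        by (intro sum.cong refl) auto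
      also have "\<dots> = (if e = e' then ?G else 0)"
        using p q by (simp add: sum_if_const)
      finally show ?thesis using t(1) by (simp add: p q)
    qed
  qed
  \<comment> \<open>Second elimination: the inverse of the scalar block is diagonal with entries
    \<open>1 / t\<close>.\<close>
  also have "\<dots> = ldet (map Inl vs) (\<lambda>p q. corona_entry a t R N (Inl p) (Inl q) -
        (\<Sum>k\<in>set (map Inr es). \<Sum>l\<in>set (map Inr es). corona_entry a t R N (Inl p) (Inl k)
          * (if k = l then 1 / t else 0) * corona_entry a t R N (Inl l) (Inl q)))
      * ldet (map Inr es) (\<lambda>p q. corona_entry a t R N (Inl p) (Inl q))"
  proof (rule ldet_schur_complement)
    show "distinct (map Inr es :: ('v + 'e) list)" using assms(1) by (simp add: distinct_map)
    show "right_inverse_on (set (map Inr es)) (\<lambda>p q. corona_entry a t R N (Inl p) (Inl q))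
        (\<lambda>k l. if k = l then 1 / t else 0)"
      unfolding right_inverse_on_def using t(2)
      by (auto simp: sum.reindex if_distrib[of "\<lambda>x. x * _"] cong: if_cong)
  qed
  also have "ldet (map Inr es) (\<lambda>p q. corona_entry a t R N (Inl p) (Inl q)) = t ^ length es"
    using ldet_diag[OF assms(1), of t] by (simp add: ldet_map)
  also have "ldet (map Inl vs) (\<lambda>p q. corona_entry a t R N (Inl p) (Inl q) -
        (\<Sum>k\<in>set (map Inr es). \<Sum>l\<in>set (map Inr es). corona_entry a t R N (Inl p) (Inl k)
          * (if k = l then 1 / t else 0) * corona_entry a t R N (Inl l) (Inl q)))
      = ldet vs (\<lambda>v w. (if v = w then a else 0) - (\<Sum>e\<in>set es. R v e * R w e) / t)"
    unfolding ldet_map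
    by (intro ldet_cong refl)
       (simp add: sum.reindex if_distrib[of "\<lambda>x. x * _"] if_distrib[of "\<lambda>x. _ * x"] sum_divide_distrib cong: if_cong)
  finally show ?thesis .
qed

section \<open>The graph matrices\<close>

lemma corona_edges:
  "edges (G1 \<ominus> G2) =
     {{Inl (Inl v), Inl (Inr e)} | v e. e \<in> edges G1 \<and> v \<in> e}
     \<union> {(\<lambda>u. Inr (Inr e, u)) ` d | e d. e \<in> edges G1 \<and> d \<in> edges G2}
     \<union> {{Inl (Inr e), Inr (Inr e, u)} | e u. e \<in> edges G1 \<and> u \<in> verts G2}"
  (is "_ = ?A \<union> ?B \<union> ?C")
proof -
  have "(\<lambda>e. Inl ` e) ` edges (subdivision_graph G1) = ?A"
    unfolding subdivision_graph_def by (auto simp: image_iff) (metis image_empty image_insert)+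
  moreover have "{(\<lambda>u. Inr (w, u)) ` d | w d. w \<in> inserted_verts G1 \<and> d \<in> edges G2} = ?B"
    unfolding inserted_verts_def by blast
  moreover have "{{Inl w, Inr (w, u)} | w u. w \<in> inserted_verts G1 \<and> u \<in> verts G2} = ?C"
    unfolding inserted_verts_def by blast
  ultimately show ?thesis
    unfolding subdivision_edge_corona_def by simp
qed

lemma corona_verts:
  "verts (G1 \<ominus> G2) = Inl ` (Inl ` verts G1 \<union> Inr ` edges G1) \<union> Inr ` (Inr ` edges G1 \<times> verts G2)"
  unfolding subdivision_edge_corona_def inserted_verts_def subdivision_graph_def by simp

lemma simple_graph_finite_edges:
  assumes "simple_graph G"
  shows "finite (edges G)"
  by (rule finite_subset[of _ "Pow (verts G)"]) (use assms in \<open>auto simp: simple_graph_def\<close>)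

lemma simple_graph_edgeD:
  assumes "simple_graph G" "e \<in> edges G"
  shows "e \<subseteq> verts G" "card e = 2" "finite e" "e \<noteq> {}"
proof -
  show "e \<subseteq> verts G" and card: "card e = 2" using assms by (auto simp: simple_graph_def)
  show "finite e" by (rule card_ge_0_finite) (simp add: card)
  show "e \<noteq> {}" using card by auto
qed

text \<open>One case per pair of vertex kinds, matching the blocks of
  \<open>corona_entry\<close>.\<close>

lemma corona_adjacency:
  fixes G1 :: "'a ugraph" and G2 :: "'b ugraph"
  shows "{Inl (Inl v), Inl (Inl v')} \<notin> edges (G1 \<ominus> G2)"
    and "{Inl (Inl v), Inl (Inr e)} \<in> edges (G1 \<ominus> G2) \<longleftrightarrow> e \<in> edges G1 \<and> v \<in> e"
    and "{Inl (Inl v), Inr p} \<notin> edges (G1 \<ominus> G2)"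
    and "{Inl (Inr e), Inl (Inr e')} \<notin> edges (G1 \<ominus> G2)"
    and "{Inl (Inr e), Inr (Inr e', u)} \<in> edges (G1 \<ominus> G2) \<longleftrightarrow> e = e' \<and> e \<in> edges G1 \<and> u \<in> verts G2"
    and "{Inr (Inr e, u), Inr (Inr e', u')} \<in> edges (G1 \<ominus> G2)
      \<longleftrightarrow> e = e' \<and> e \<in> edges G1 \<and> {u, u'} \<in> edges G2"
proof -
  \<comment> \<open>An edge inside a copy determines the copy from its endpoints, and then the edge
    of \<open>G2\<close> by injectivity of \<open>?h\<close>.\<close>
  have image: "{Inr (Inr e, u), Inr (Inr e', u')} =
        ((\<lambda>u. Inr (Inr e'', u)) ` d :: (('a + 'a set) + ('a + 'a set) \<times> 'b) set)
      \<longleftrightarrow> e = e'' \<and> e' = e'' \<and> d = {u, u'}" (is "{?a, ?b} = ?h ` d \<longleftrightarrow> ?r")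
    for e e' e'' :: "'a set" and u u' and d :: "'b set"
  proof
    assume eq: "{?a, ?b} = ?h ` d"
    have "?a \<in> ?h ` d" "?b \<in> ?h ` d" unfolding eq[symmetric] by simp_all
    hence e: "e = e''" "e' = e''" by auto
    have "inj ?h" by (simp add: inj_def)
    moreover have "?h ` {u, u'} = ?h ` d" using eq e by simp
    ultimately have "{u, u'} = d" by (simp only: inj_image_eq_iff)
    thus ?r using e by simp
  qed simp
  have no_Inl: "{Inl a, b} \<noteq> (\<lambda>u. Inr (Inr e, u)) ` d"
    for a :: "'a + 'a set" and b :: "('a + 'a set) + ('a + 'a set) \<times> 'b" and e d
    by (metis (no_types) imageE insertI1 sum.distinct(1))
  show "{Inl (Inl v), Inl (Inl v')} \<notin> edges (G1 \<ominus> G2)"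
    and "{Inl (Inl v), Inl (Inr e)} \<in> edges (G1 \<ominus> G2) \<longleftrightarrow> e \<in> edges G1 \<and> v \<in> e"
    and "{Inl (Inl v), Inr p} \<notin> edges (G1 \<ominus> G2)"
    and "{Inl (Inr e), Inl (Inr e')} \<notin> edges (G1 \<ominus> G2)"
    and "{Inl (Inr e), Inr (Inr e', u)} \<in> edges (G1 \<ominus> G2) \<longleftrightarrow> e = e' \<and> e \<in> edges G1 \<and> u \<in> verts G2"
    unfolding corona_edges
    by (simp_all add: doubleton_eq_iff no_Inl conj_commute) blast
  show "{Inr (Inr e, u), Inr (Inr e', u')} \<in> edges (G1 \<ominus> G2)
      \<longleftrightarrow> e = e' \<and> e \<in> edges G1 \<and> {u, u'} \<in> edges G2"
    unfolding corona_edges by (simp add: doubleton_eq_iff image) blast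
qed

section \<open>Vertex degrees in the corona\<close>

lemma corona_degree_vertex:
  fixes G1 :: "'a ugraph" and G2 :: "'b ugraph"
  shows "vdegree (G1 \<ominus> G2) (Inl (Inl v)) = vdegree G1 v"
proof -
  let ?f = "\<lambda>e. {Inl (Inl v), Inl (Inr e)} :: (('a + 'a set) + ('a + 'a set) \<times> 'b) set"
  have "{d \<in> edges (G1 \<ominus> G2). Inl (Inl v) \<in> d} = ?f ` {e \<in> edges G1. v \<in> e}"
    unfolding corona_edges by auto
  moreover have "inj_on ?f {e \<in> edges G1. v \<in> e}"
    by (auto simp: inj_on_def doubleton_eq_iff)
  ultimately show ?thesis by (simp add: vdegree_def card_image)
qed

text \<open>The 2 counts the two halves of the subdivided edge; the rest are the join edges to its
  copy.\<close>

lemma corona_degree_inserted: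
  fixes G1 :: "'a ugraph" and G2 :: "'b ugraph"
  assumes "simple_graph G1" "simple_graph G2" "e \<in> edges G1"
  shows "vdegree (G1 \<ominus> G2) (Inl (Inr e)) = 2 + card (verts G2)"
proof -
  let ?f = "\<lambda>v. {Inl (Inl v), Inl (Inr e)} :: (('a + 'a set) + ('a + 'a set) \<times> 'b) set"
  let ?g = "\<lambda>u. {Inl (Inr e), Inr (Inr e, u)} :: (('a + 'a set) + ('a + 'a set) \<times> 'b) set"
  have "{d \<in> edges (G1 \<ominus> G2). Inl (Inr e) \<in> d} = ?f ` e \<union> ?g ` verts G2"
    unfolding corona_edges using assms(3) by auto
  moreover have "card (?f ` e \<union> ?g ` verts G2) = card (?f ` e) + card (?g ` verts G2)"
    using assms(2) simple_graph_edgeD[OF assms(1,3)]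
    by (intro card_Un_disjoint) (auto simp: simple_graph_def doubleton_eq_iff)
  moreover have "inj_on ?f e" "inj_on ?g (verts G2)"
    by (auto simp: inj_on_def doubleton_eq_iff)
  ultimately show ?thesis
    using simple_graph_edgeD[OF assms(1,3)] by (simp add: vdegree_def card_image)
qed

lemma corona_degree_copy:
  fixes G1 :: "'a ugraph" and G2 :: "'b ugraph"
  assumes "simple_graph G1" "simple_graph G2" "e \<in> edges G1" "u \<in> verts G2"
  shows "vdegree (G1 \<ominus> G2) (Inr (Inr e, u)) = vdegree G2 u + 1"
proof -
  let ?f = "\<lambda>d. (\<lambda>u. Inr (Inr e, u)) ` d :: (('a + 'a set) + ('a + 'a set) \<times> 'b) set"
  let ?D = "{d \<in> edges G2. u \<in> d}"
  have "{d \<in> edges (G1 \<ominus> G2). Inr (Inr e, u) \<in> d} = insert {Inl (Inr e), Inr (Inr e, u)} (?f ` ?D)"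
    unfolding corona_edges using assms(3,4) by auto
  moreover have "{Inl (Inr e), Inr (Inr e, u)} \<notin> ?f ` ?D" by auto
  moreover have "inj_on ?f ?D"
    by (rule inj_on_subset[OF _ subset_UNIV], rule injI, subst (asm) inj_image_eq_iff) (auto simp: inj_def)
  moreover have "finite ?D" using simple_graph_finite_edges[OF assms(2)] by simp
  ultimately show ?thesis
    by (simp add: vdegree_def card_image)
qed

section \<open>Signless Laplacians: entries, incidence factorization, spectrum\<close>

definition signless_entry :: "'a ugraph \<Rightarrow> 'a \<Rightarrow> 'a \<Rightarrow> real" where
  "signless_entry G u v =
     (if u = v then real (vdegree G u) else 0) + (if {u, v} \<in> edges G then 1 else 0)"

lemma signless_entry_sym: "signless_entry G u v = signless_entry G v u"
  by (simp add: signless_entry_def insert_commute)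

lemma signless_laplacian_conv_lmat:
  assumes "distinct vs"
  shows "signless_laplacian vs G = lmat vs (signless_entry G)"
  unfolding signless_laplacian_def degree_matrix_def adjacency_matrix_def signless_entry_def
  by (intro eq_matI) (auto simp: nth_eq_iff_index_eq[OF assms])

text \<open>The sum counts the edges containing both \<open>v\<close> and \<open>w\<close>. For
  \<open>v = w\<close> this is the degree; otherwise only the edge \<open>{v, w}\<close> can occur,
  since edges have two elements.\<close>

lemma incidence_mult_transpose:
  assumes "simple_graph G"
  shows "(\<Sum>e\<in>edges G. (if v \<in> e then 1 else 0) * (if w \<in> e then 1 else 0)) = signless_entry G v w"
proof -
  have "(\<Sum>e\<in>edges G. (if v \<in> e then 1 else 0) * (if w \<in> e then 1 else (0::real)))
      = (\<Sum>e\<in>edges G. if v \<in> e \<and> w \<in> e then 1 else 0)"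
    by (intro sum.cong) auto
  also have "\<dots> = real (card {e \<in> edges G. v \<in> e \<and> w \<in> e})"
    using simple_graph_finite_edges[OF assms] by (simp add: sum.If_cases Int_def)
  also have "\<dots> = signless_entry G v w"
  proof (cases "v = w")
    case True
    \<comment> \<open>For \<open>v = w\<close> the adjacency term asks for a loop, which simplicity
      excludes.\<close>
    have "{w} \<notin> edges G" using simple_graph_edgeD(2)[OF assms, of "{w}"] by auto
    thus ?thesis using True by (simp add: signless_entry_def vdegree_def)
  next
    case False
    have "e = {v, w}" if "e \<in> edges G" "v \<in> e" "w \<in> e" for e
      using that simple_graph_edgeD(2,3)[OF assms that(1)] False
      by (intro card_subset_eq[symmetric]) auto
    hence "e \<in> edges G \<and> v \<in> e \<and> w \<in> e \<longleftrightarrow> e = {v, w} \<and> {v, w} \<in> edges G" for e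
      by (metis insertI1 insertI2)
    hence "{e \<in> edges G. v \<in> e \<and> w \<in> e} = (if {v, w} \<in> edges G then {{v, w}} else {})"
      by simp
    thus ?thesis using False by (simp add: signless_entry_def)
  qed
  finally show ?thesis .
qed

text \<open>Evaluates the factored characteristic polynomial at a rational function
  \<open>y\<close>. It is needed at \<open>x - 1\<close> for the copies of \<open>G2\<close> and at
  \<open>(x - r1) t\<close> for \<open>G1\<close>.\<close>

lemma ldet_signless_entry:
  fixes y :: ratfun
  assumes "distinct vs"
  shows "ldet vs (\<lambda>u v. (if u = v then y else 0) - ratC (signless_entry G u v))
    = (\<Prod>i=1..length vs. y - ratC (signless_eigenvalue vs G i))"
proof -
  interpret ratC: comm_ring_hom ratC by (rule comm_ring_hom_ratC)
  interpret map_ratC: map_poly_comm_ring_hom ratC ..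
  let ?h = "\<lambda>p. poly (map_poly ratC p) y"
  have h: "comm_ring_hom ?h"
    by unfold_locales (simp_all add: map_ratC.hom_add map_ratC.hom_mult)
  then interpret h: comm_ring_hom ?h .
  let ?M = "signless_laplacian vs G"
  have M: "?M = lmat vs (signless_entry G)" by (rule signless_laplacian_conv_lmat[OF assms])
  have roots: "char_poly ?M = (\<Prod>a\<in>#proots (char_poly ?M). [:- a, 1:])"
    "size (proots (char_poly ?M)) = length vs"
    by (rule char_poly_real_symmetric_splits[of ?M "length vs"];
        simp add: M signless_entry_sym[of G])+
  have "ldet vs (\<lambda>u v. (if u = v then y else 0) - ratC (signless_entry G u v)) = ?h (char_poly ?M)"
    unfolding M hom_char_poly[OF h assms]
    by (intro ldet_cong refl) (simp add: ratC.map_poly_pCons_hom)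
  also have "\<dots> = (\<Prod>a\<in>#proots (char_poly ?M). y - ratC a)"
    by (subst roots(1), subst h.hom_prod_mset) (simp add: multiset.map_comp o_def ratC.hom_uminus ratC.map_poly_pCons_hom)
  also have "\<dots> = (\<Prod>i=1..length vs. y - ratC (signless_eigenvalue vs G i))"
    unfolding prod_mset_conv_sorted_list roots(2) signless_eigenvalue_def ..
  finally show ?thesis .
qed

text \<open>The block computation labels a copy by the edge \<open>e\<close> itself, whereas the
  corona labels it by the inserted vertex \<open>Inr e\<close>; this map translates.\<close>

definition corona_embedding ::
    "('a + 'a set) + 'a set \<times> 'b \<Rightarrow> ('a + 'a set) + ('a + 'a set) \<times> 'b" where
  "corona_embedding = map_sum id (map_prod Inr id)"

lemma corona_embedding_simps [simp]:
  "corona_embedding (Inl p) = Inl p"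
  "corona_embedding (Inr (e, u)) = Inr (Inr e, u)"
  by (simp_all add: corona_embedding_def)

lemma inj_corona_embedding: "inj corona_embedding"
  unfolding corona_embedding_def by (intro sum.inj_map prod.inj_map) auto

text \<open>Regularity makes the diagonal constant on the vertices of \<open>G1\<close>; the join
  edges contribute \<open>card (verts G2)\<close> at inserted vertices and 1 at each vertex of a
  copy, hence \<open>x - 1\<close> in the last block.\<close>

lemma corona_signless_entry:
  fixes G1 :: "'a ugraph" and G2 :: "'b ugraph"
  assumes "simple_graph G1" "regular_graph r1 G1" "simple_graph G2"
    and p: "p \<in> Inl ` (Inl ` verts G1 \<union> Inr ` edges G1) \<union> Inr ` (edges G1 \<times> verts G2)"
    and q: "q \<in> Inl ` (Inl ` verts G1 \<union> Inr ` edges G1) \<union> Inr ` (edges G1 \<times> verts G2)"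
  shows "(if corona_embedding p = corona_embedding q then x else 0)
      - ratC (signless_entry (G1 \<ominus> G2) (corona_embedding p) (corona_embedding q))
    = corona_entry (x - of_nat r1) (x - 2 - of_nat (card (verts G2))) (\<lambda>v e. if v \<in> e then 1 else 0)
        (\<lambda>u v. (if u = v then x - 1 else 0) - ratC (signless_entry G2 u v)) p q"
proof -
  interpret ratC: comm_ring_hom ratC by (rule comm_ring_hom_ratC)
  have [simp]: "ratC 0 = 0" "ratC 1 = 1" "ratC (real n) = of_nat n" "ratC (1 + real n) = 1 + of_nat n"
      "ratC (2 + real n) = 2 + of_nat n" for n
    using ratC_of_nat[of 2] by (simp_all add: ratC.hom_add ratC_of_nat)
  have r1: "vdegree G1 v = r1" if "v \<in> verts G1" for v
    using assms(2) that by (simp add: regular_graph_def)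
  note comm = insert_commute[of "Inl (Inr _)" "Inl (Inl _)"] insert_commute[of "Inr _" "Inl _"]
  note deg = corona_degree_vertex corona_degree_inserted[OF assms(1,3)] corona_degree_copy[OF assms(1,3)]
  note entry = signless_entry_def[of "G1 \<ominus> G2"] corona_adjacency comm deg r1
  consider (v) v where "p = Inl (Inl v)" "v \<in> verts G1" | (e) e where "p = Inl (Inr e)" "e \<in> edges G1"
    | (u) e u where "p = Inr (e, u)" "e \<in> edges G1" "u \<in> verts G2"
    using p by blast
  note p_cases = this
  consider (v) v where "q = Inl (Inl v)" "v \<in> verts G1" | (e) e where "q = Inl (Inr e)" "e \<in> edges G1"
    | (u) e u where "q = Inr (e, u)" "e \<in> edges G1" "u \<in> verts G2"
    using q by blast
  thus ?thesis
  proof cases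
    case q: v
    from p_cases show ?thesis by cases (simp_all add: q entry)
  next
    case q: e
    from p_cases show ?thesis by cases (simp_all add: q entry)
  next
    case q: u
    from p_cases show ?thesis
    proof cases
      case p: u
      \<comment> \<open>Within one copy the entry is that of \<open>G2\<close> plus 1 on the
        diagonal for the join edge; distinct copies are not adjacent.\<close>
      have "signless_entry (G1 \<ominus> G2) (corona_embedding p) (corona_embedding q)
          = (if fst (projr p) = fst (projr q) then (if snd (projr p) = snd (projr q) then 1 else 0)
              + signless_entry G2 (snd (projr p)) (snd (projr q)) else 0)"
        using p q by (simp add: entry) (simp add: signless_entry_def)
      thus ?thesis using p q by (simp add: ratC.hom_add)
    qed (simp_all add: q entry)
  qed
qed

section \<open>Assembly of the factorization\<close>

theorem theorem3p11:
  fixes G1 :: "'a ugraph" and G2 :: "'b ugraph"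
    and vs1 :: "'a list" and vs2 :: "'b list"
    and vs :: "(('a + 'a set) + ('a + 'a set) \<times> 'b) list"
    and r1 n1 m1 n2 :: nat
  assumes "simple_graph G1" and "regular_graph r1 G1"
    and "card (verts G1) = n1" and "card (edges G1) = m1"
    and "simple_graph G2" and "card (verts G2) = n2"
    and "enumerates vs1 G1" and "enumerates vs2 G2" and "enumerates vs (G1 \<ominus> G2)"
  shows "let x = ratX; \<Gamma> = ratfun_at (coronal (signless_laplacian vs2 G2)) [:-1, 1:] in
    to_fract (char_poly (signless_laplacian vs (G1 \<ominus> G2))) =
      (x - 2 - of_nat n2 - \<Gamma>) powi (int m1 - int n1)
      * (\<Prod>i=1..n2. (x - 1 - ratC (signless_eigenvalue vs2 G2 i)) ^ m1)
      * (\<Prod>i=1..n1. x\<^sup>2 - (2 + of_nat r1 + of_nat n2 + \<Gamma>) * x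
            + of_nat r1 * (2 + of_nat n2 + \<Gamma>) - ratC (signless_eigenvalue vs1 G1 i))"
proof -
  interpret ratC: comm_ring_hom ratC by (rule comm_ring_hom_ratC)
  have vs1: "distinct vs1" "set vs1 = verts G1" "length vs1 = n1"
    and vs2: "distinct vs2" "set vs2 = verts G2" "length vs2 = n2"
    and vs: "distinct vs" "set vs = verts (G1 \<ominus> G2)"
    using assms(3,6-9) distinct_card[of vs1] distinct_card[of vs2] by (auto simp: enumerates_def)
  obtain es where es: "distinct es" "set es = edges G1"
    using finite_distinct_list[OF simple_graph_finite_edges[OF assms(1)]] by blast
  hence m1: "length es = m1" using assms(4) distinct_card[of es] by simp
  define \<Gamma> where "\<Gamma> = ratfun_at (coronal (signless_laplacian vs2 G2)) [:-1, 1:]"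
  define t where "t = ratX - 2 - of_nat n2 - \<Gamma>"
  define a where "a = ratX - of_nat r1"
  define N where "N u v = (if u = v then ratX - 1 else 0) - ratC (signless_entry G2 u v)" for u v
  have shift: "to_fract [:-1, 1:] = ratX - 1"
    by (simp add: ratX_def one_pCons flip: to_fract_diff to_fract_1)
  \<comment> \<open>The shifts are \<open>2 + n2\<close> at the corner and 1 in the block. By
    \<open>ldet_bordered\<close> this determinant is \<open>t\<close> times that of
    \<open>N\<close>, so \<open>t\<close> is nonzero.\<close>
  have bnz: "ldet (None # map Some vs2) (bordered (ratX - 2 - of_nat n2) N) \<noteq> 0"
    using ldet_bordered_char_matrix_nonzero[OF vs2(1), of "2 + real n2" 1 "signless_entry G2"]
      ratC_of_nat[of "2 + n2"] 
    unfolding N_def[abs_def] by (simp add: algebra_simps cong: if_cong)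
  have detN: "ldet vs2 N = (\<Prod>i=1..n2. ratX - 1 - ratC (signless_eigenvalue vs2 G2 i))"
    unfolding N_def[abs_def] ldet_signless_entry[OF vs2(1)] vs2(3) ..
  \<comment> \<open>A monic polynomial stays nonzero after substituting \<open>x - 1\<close>, so
    \<open>N\<close> is invertible.\<close>
  have "ldet vs2 N = to_fract (pcompose (char_poly (signless_laplacian vs2 G2)) [:-1, 1:])"
    unfolding signless_laplacian_conv_lmat[OF vs2(1)] N_def[abs_def]
      hom_char_poly[OF comm_ring_hom_to_fract_pcompose vs2(1)]
    by (simp add: shift[symmetric] ratC_def pcompose_pCons cong: if_cong)
  moreover have "char_poly (signless_laplacian vs2 G2) \<noteq> 0"
    using degree_monic_char_poly[of "signless_laplacian vs2 G2" n2] vs2(3)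
    by (auto simp: signless_laplacian_conv_lmat[OF vs2(1)])
  ultimately have "ldet vs2 N \<noteq> 0"
    by (simp add: pcompose_eq_0_iff)
  then obtain g where g: "right_inverse_on (set vs2) N g"
    using mat_inverse_lmat[OF vs2(1)] by metis
  have \<Gamma>: "\<Gamma> = (\<Sum>u\<in>set vs2. \<Sum>v\<in>set vs2. g u v)"
    unfolding \<Gamma>_def signless_laplacian_conv_lmat[OF vs2(1)]
    using g unfolding N_def[abs_def] by (intro ratfun_at_coronal vs2(1)) (simp_all add: shift cong: if_cong)
  have t: "t = ratX - 2 - of_nat n2 - (\<Sum>u\<in>set vs2. \<Sum>v\<in>set vs2. g u v)"
    unfolding t_def \<Gamma> ..
  have tnz: "t \<noteq> 0"
    using bnz ldet_bordered[OF vs2(1) g, of "ratX - 2 - of_nat n2"] t by auto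

  \<comment> \<open>The block order, with copies labelled by edges; after
    \<open>corona_embedding\<close> it is a rearrangement of \<open>vs\<close>.\<close>
  define ws where "ws = map Inl (map Inl vs1 @ map Inr es) @ map Inr (List.product es vs2)"
  have set_ws: "set ws = Inl ` (Inl ` verts G1 \<union> Inr ` edges G1) \<union> Inr ` (edges G1 \<times> verts G2)"
    by (simp add: ws_def vs1 vs2 es image_Un image_image Un_assoc)
  have "distinct ws"
    using vs1(1) vs2(1) es(1) by (auto simp: ws_def distinct_map distinct_product inj_on_def)
  hence "distinct (map corona_embedding ws)"
    using inj_on_subset[OF inj_corona_embedding subset_UNIV] by (simp add: distinct_map)
  moreover have "corona_embedding ` Inr ` (edges G1 \<times> verts G2) = Inr ` (Inr ` edges G1 \<times> verts G2)"
    by force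
  hence "set (map corona_embedding ws) = set vs"
    unfolding vs(2) corona_verts by (simp add: set_ws image_Un image_image)
  ultimately have mset: "mset vs = mset (map corona_embedding ws)"
    using vs(1) set_eq_iff_mset_eq_distinct by metis
  let ?R = "\<lambda>v e. if v \<in> e then 1 else 0 :: ratfun"
  have RR: "(\<Sum>e\<in>set es. ?R v e * ?R w e) = ratC (signless_entry G1 v w)" for v w
    unfolding es(2) incidence_mult_transpose[OF assms(1), symmetric] ratC.hom_sum
    by (intro sum.cong) auto
  have "to_fract (char_poly (signless_laplacian vs (G1 \<ominus> G2)))
      = ldet vs (\<lambda>u v. (if u = v then ratX else 0) - ratC (signless_entry (G1 \<ominus> G2) u v))"
    unfolding signless_laplacian_conv_lmat[OF vs(1)] ratX_def ratC_def
    by (rule hom_char_poly[OF comm_ring_hom_to_fract vs(1)])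
  also have "\<dots> = ldet ws (\<lambda>p q. (if corona_embedding p = corona_embedding q then ratX else 0)
      - ratC (signless_entry (G1 \<ominus> G2) (corona_embedding p) (corona_embedding q)))"
    unfolding ldet_mset_eq[OF mset] ldet_map ..
  also have "\<dots> = ldet ws (corona_entry a (ratX - 2 - of_nat n2) ?R N)"
    unfolding a_def N_def[abs_def] assms(6)[symmetric]
    by (intro ldet_cong refl corona_signless_entry assms) (simp_all add: set_ws)
  also have "\<dots> = ldet vs1 (\<lambda>v w. (if v = w then a else 0) - (\<Sum>e\<in>set es. ?R v e * ?R w e) / t)
      * t ^ m1 * ldet vs2 N ^ m1"
    unfolding ws_def ldet_corona[OF es(1) vs2(1) g t tnz] m1 ..
  \<comment> \<open>Taking \<open>1 / t\<close> out of each of the \<open>n1\<close> rows turns the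
    matrix into \<open>a t I - Q(G1)\<close>.\<close>
  also have "ldet vs1 (\<lambda>v w. (if v = w then a else 0) - (\<Sum>e\<in>set es. ?R v e * ?R w e) / t)
      = ldet vs1 (\<lambda>v w. inverse t * ((if v = w then a * t else 0) - ratC (signless_entry G1 v w)))"
    unfolding RR using tnz by (intro ldet_cong refl) (simp add: field_simps)
  also have "\<dots> = inverse t ^ n1 * (\<Prod>i=1..n1. a * t - ratC (signless_eigenvalue vs1 G1 i))"
    unfolding ldet_smult ldet_signless_entry[OF vs1(1)] vs1(3) ..
  also have "(\<Prod>i=1..n1. a * t - ratC (signless_eigenvalue vs1 G1 i))
      = (\<Prod>i=1..n1. ratX\<^sup>2 - (2 + of_nat r1 + of_nat n2 + \<Gamma>) * ratX
            + of_nat r1 * (2 + of_nat n2 + \<Gamma>) - ratC (signless_eigenvalue vs1 G1 i))" (is "_ = ?P")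
    by (intro prod.cong refl) (simp add: a_def t_def algebra_simps power2_eq_square)
  \<comment> \<open>The powers of \<open>t\<close> combine to an integer power, whose exponent is
    negative when \<open>m1 < n1\<close>; this is where \<open>t\<close> must be nonzero.\<close>
  also have "inverse t ^ n1 * ?P * t ^ m1 * ldet vs2 N ^ m1
      = t powi (int m1 - int n1) * (\<Prod>i=1..n2. (ratX - 1 - ratC (signless_eigenvalue vs2 G2 i)) ^ m1) * ?P"
    using tnz by (simp add: detN prod_power_distrib power_int_diff power_inverse field_simps)
  finally show ?thesis
    unfolding Let_def t_def \<Gamma>_def .
qed

end
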